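(* For every integer $m\ge1$, the number of spanning trees of any linear 2-tree with $m$ triangles is $F_{2m+2}$.
   Context: A 2-tree is built inductively from a triangle by repeatedly adding a new vertex adjacent to both endpoints of an existing edge. A linear 2-tree is a graph constructed inductively by starting with a triangle and repeatedly connecting a new vertex to both endpoints of an existing edge that includes a vertex of degree 2; equivalently, a 2-tree with exactly two vertices of degree 2. A linear 2-tree on $n$ vertices has $m=n-2$ triangles. $F_p$ denotes the Fibonacci numbers ($F_0=0,F_1=1,F_{p+1}=F_p+F_{p-1}$). *)

theory Defs
  imports "HOL-Number_Theory.Fib"
begin

text \<open>
  A finite simple graph is given by its vertex set and its edge set, the latter consisting of
  two-element subsets of the vertex set.
\<close>

definition degree :: "'a set set \<Rightarrow> 'a \<Rightarrow> nat" where
  "degree E v = card {e \<in> E. v \<in> e}"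

definition triangles :: "'a set \<Rightarrow> 'a set set \<Rightarrow> 'a set set" where
  "triangles V E = {t. t \<subseteq> V \<and> card t = 3 \<and> (\<forall>x\<in>t. \<forall>y\<in>t. x \<noteq> y \<longrightarrow> {x, y} \<in> E)}"

text \<open>
  The triangle itself is a linear 2-tree, although all three of its vertices have degree 2.  In the
  second rule the edge is unordered, so \<open>u\<close> may be either of its endpoints; the degree is that
  before the new vertex \<open>w\<close> is added.
\<close>

inductive linear_2tree :: "'a set \<Rightarrow> 'a set set \<Rightarrow> bool" where
  triangle: "distinct [a, b, c] \<Longrightarrow> linear_2tree {a, b, c} {{a, b}, {b, c}, {a, c}}"
| extend: "\<lbrakk>linear_2tree V E; {u, v} \<in> E; degree E u = 2; w \<notin> V\<rbrakk>
    \<Longrightarrow> linear_2tree (insert w V) (E \<union> {{w, u}, {w, v}})"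

definition walk :: "'a set \<Rightarrow> 'a set set \<Rightarrow> 'a list \<Rightarrow> bool" where
  "walk V E xs \<longleftrightarrow> xs \<noteq> [] \<and> set xs \<subseteq> V \<and> successively (\<lambda>x y. {x, y} \<in> E) xs"

definition graph_connected :: "'a set \<Rightarrow> 'a set set \<Rightarrow> bool" where
  "graph_connected V E \<longleftrightarrow>
     V \<noteq> {} \<and> (\<forall>u\<in>V. \<forall>v\<in>V. \<exists>xs. walk V E xs \<and> hd xs = u \<and> last xs = v)"

text \<open>A cycle is the list of its vertices, without repeating the first one at the end.\<close>

definition graph_cycle :: "'a set \<Rightarrow> 'a set set \<Rightarrow> 'a list \<Rightarrow> bool" where
  "graph_cycle V E xs \<longleftrightarrow>
     walk V E xs \<and> length xs \<ge> 3 \<and> distinct xs \<and> {last xs, hd xs} \<in> E"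

definition graph_tree :: "'a set \<Rightarrow> 'a set set \<Rightarrow> bool" where
  "graph_tree V E \<longleftrightarrow> graph_connected V E \<and> (\<nexists>xs. graph_cycle V E xs)"

text \<open>
  A spanning tree has the vertex set of the whole graph, so it is identified with its edge set.
  Distinct but isomorphic spanning trees count separately.
\<close>

definition spanning_trees :: "'a set \<Rightarrow> 'a set set \<Rightarrow> 'a set set set" where
  "spanning_trees V E = {T. T \<subseteq> E \<and> graph_tree V T}"

end

theory Submission
  imports Defs
begin

text \<open>
  Let \<open>N S\<close> be the number of spanning trees that contain the edge set \<open>S\<close>.  When a vertex \<open>w\<close> is
  attached to the edge \<open>uv\<close>, a spanning tree of the new graph either has \<open>w\<close> as a leaf, or arises
  from a spanning tree through \<open>uv\<close> by subdividing \<open>uv\<close> with \<open>w\<close>.  Hence, for \<open>uv\<close> not in \<open>S\<close>, the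
  new counts are \<open>N' S = 2 * N S + N (S + uv)\<close> and \<open>N' (S + wu) = N S + N (S + uv)\<close>.  With \<open>m\<close>
  triangles, this recursion preserves \<open>N {} = fib (2m + 2)\<close>, \<open>N {e} = fib (2m + 1)\<close> and
  \<open>N {e, f} = fib (2m)\<close>, where \<open>e\<close> and \<open>f\<close> are distinct edges at distinct vertices of degree 2.
\<close>

section \<open>Reachability and acyclicity\<close>

text \<open>No vertex set enters, so edge sets can be varied alone; every point reaches itself, even
  one outside the graph.\<close>

definition conn :: "'a set set \<Rightarrow> 'a \<Rightarrow> 'a \<Rightarrow> bool" where
  "conn T = (\<lambda>x y. {x, y} \<in> T)\<^sup>*\<^sup>*"

text \<open>Freedom from cycles, encoded as every edge being a bridge, so that no lists of vertices
  are involved. A loop \<open>{a}\<close> counts as a cycle because \<open>conn\<close> is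
  reflexive.\<close>

definition acyclic_edges :: "'a set set \<Rightarrow> bool" where
  "acyclic_edges T \<longleftrightarrow> (\<forall>a b. {a, b} \<in> T \<longrightarrow> \<not> conn (T - {{a, b}}) a b)"

lemma conn_refl [simp, intro]: "conn T x x"
  by (simp add: conn_def)

lemma conn_edge: "{x, y} \<in> T \<Longrightarrow> conn T x y"
  by (auto simp: conn_def)

lemma conn_trans: "conn T x y \<Longrightarrow> conn T y z \<Longrightarrow> conn T x z"
  unfolding conn_def by (rule rtranclp_trans)

lemma conn_induct [consumes 1, case_names base step]:
  assumes "conn T x y" "P x" "\<And>y z. conn T x y \<Longrightarrow> {y, z} \<in> T \<Longrightarrow> P y \<Longrightarrow> P z"
  shows "P y"
  using assms unfolding conn_def by (rule rtranclp_induct)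

lemma conn_sym: "conn T x y \<Longrightarrow> conn T y x"
proof (induction rule: conn_induct)
  case (step y z)
  then have "{z, y} \<in> T" by (simp add: insert_commute)
  with step.IH show ?case by (blast intro: conn_edge conn_trans)
qed simp

lemma conn_mono: "conn S x y \<Longrightarrow> S \<subseteq> T \<Longrightarrow> conn T x y"
  by (induction rule: conn_induct) (auto intro: conn_edge conn_trans)

text \<open>A path never has to cross the new edge more than once. Reachability after adding an edge
  thus becomes a propositional combination of old reachabilities, which is how the later tree lemmas
  are computed.\<close>

lemma conn_insert_iff:
  "conn (insert {a, b} T) x y \<longleftrightarrow>
     conn T x y \<or> (conn T x a \<and> conn T b y) \<or> (conn T x b \<and> conn T a y)"
    (is "?L \<longleftrightarrow> ?R")
proof
  assume ?L
  then show ?R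
  proof (induction rule: conn_induct)
    case (step y z)
    from step.hyps(2) consider "{y, z} \<in> T" | "y = a" "z = b" | "y = b" "z = a"
      by (auto simp: doubleton_eq_iff)
    then show ?case
      using step.IH by cases (blast intro: conn_edge conn_trans)+
  qed simp
next
  have sub: "conn T p q \<Longrightarrow> conn (insert {a, b} T) p q" for p q
    by (rule conn_mono) auto
  have ab: "conn (insert {a, b} T) a b" "conn (insert {a, b} T) b a"
    by (auto simp: insert_commute intro: conn_edge)
  assume ?R
  then show ?L
    using sub ab by (meson conn_trans)
qed

lemma acyclic_edges_mono: "acyclic_edges T \<Longrightarrow> S \<subseteq> T \<Longrightarrow> acyclic_edges S"
  unfolding acyclic_edges_def by (blast intro: conn_mono)

text \<open>A cycle through the new edge is that edge together with a path in \<open>T\<close> from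
  \<open>a\<close> to \<open>b\<close>. If an old edge \<open>cd\<close> were bypassed by way of
  \<open>ab\<close>, then \<open>cd\<close> and the rest of the bypass would form such a
  path.\<close>

lemma acyclic_edges_insert:
  assumes "{a, b} \<notin> T"
  shows "acyclic_edges (insert {a, b} T) \<longleftrightarrow> acyclic_edges T \<and> \<not> conn T a b"
proof
  assume L: "acyclic_edges (insert {a, b} T)"
  moreover have "insert {a, b} T - {{a, b}} = T" using assms by auto
  ultimately show "acyclic_edges T \<and> \<not> conn T a b"
    by (metis acyclic_edges_def acyclic_edges_mono insertI1 subset_insertI)
next
  assume R: "acyclic_edges T \<and> \<not> conn T a b"
  show "acyclic_edges (insert {a, b} T)"
    unfolding acyclic_edges_def
  proof (intro allI impI notI)
    fix c d
    assume cd: "{c, d} \<in> insert {a, b} T"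
      and cn: "conn (insert {a, b} T - {{c, d}}) c d"
    show False
    proof (cases "{c, d} = {a, b}")
      case True
      then have "insert {a, b} T - {{c, d}} = T" using assms by auto
      with cn have "conn T c d" by simp
      with True R show False by (metis conn_sym doubleton_eq_iff)
    next
      case False
      with cd have cdT: "{c, d} \<in> T" by simp
      have "insert {a, b} T - {{c, d}} = insert {a, b} (T - {{c, d}})" using False by auto
      with cn have "conn (T - {{c, d}}) c d
          \<or> (conn (T - {{c, d}}) c a \<and> conn (T - {{c, d}}) b d)
          \<or> (conn (T - {{c, d}}) c b \<and> conn (T - {{c, d}}) a d)"
        by (simp add: conn_insert_iff)
      moreover have "\<not> conn (T - {{c, d}}) c d"
        using R cdT by (simp add: acyclic_edges_def)
      moreover have "conn (T - {{c, d}}) p q \<Longrightarrow> conn T p q" for p q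
        by (rule conn_mono) auto
      moreover have "conn T c d" using cdT by (rule conn_edge)
      ultimately show False using R by (meson conn_sym conn_trans)
    qed
  qed
qed

lemma conn_fresh:
  assumes "\<And>e. e \<in> T \<Longrightarrow> w \<notin> e"
  shows "conn T x w \<longleftrightarrow> x = w" "conn T w x \<longleftrightarrow> x = w"
proof -
  have "conn T w x \<Longrightarrow> x = w"
    by (induction rule: conn_induct) (use assms in auto)
  then show "conn T w x \<longleftrightarrow> x = w" "conn T x w \<longleftrightarrow> x = w"
    by (auto dest: conn_sym)
qed

lemma conn_empty [simp]: "conn {} x y \<longleftrightarrow> x = y"
  by (metis conn_fresh(1) empty_iff)

section \<open>Trees in terms of reachability\<close>

definition simple_edges :: "'a set \<Rightarrow> 'a set set \<Rightarrow> bool" where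
  "simple_edges V T \<longleftrightarrow> (\<forall>e\<in>T. e \<subseteq> V \<and> card e = 2)"

lemma simple_edgesD:
  assumes "simple_edges V T" "{x, y} \<in> T"
  shows "x \<in> V" "y \<in> V" "x \<noteq> y"
  using assms unfolding simple_edges_def by force+

lemma walk_imp_conn: "walk V T xs \<Longrightarrow> conn T (hd xs) (last xs)"
proof (induction xs)
  case (Cons x xs)
  show ?case
  proof (cases xs)
    case (Cons y ys)
    with Cons.prems have "walk V T xs" "{x, y} \<in> T" by (auto simp: walk_def)
    with Cons.IH Cons show ?thesis by (auto intro: conn_edge conn_trans)
  qed simp
qed (simp add: walk_def)

text \<open>Walks without repetition are wanted because \<open>graph_cycle\<close> demands distinct
  vertices.\<close>

lemma conn_imp_distinct_walk:
  assumes "conn T x y" "simple_edges V T" "x \<in> V"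
  shows "\<exists>xs. walk V T xs \<and> distinct xs \<and> hd xs = x \<and> last xs = y"
  using assms(1)
proof (induction rule: conn_induct)
  case base
  show ?case by (rule exI[of _ "[x]"]) (simp add: walk_def assms)
next
  case (step y z)
  then obtain xs where xs: "walk V T xs" "distinct xs" "hd xs = x" "last xs = y" by blast
  have z: "z \<in> V" using simple_edgesD[OF assms(2) step.hyps(2)] by blast
  show ?case
  proof (cases "z \<in> set xs")
    \<comment> \<open>The walk returns to \<open>z\<close>, so it is cut off at the visit already
      made.\<close>
    case True
    then obtain ys zs where "xs = ys @ z # zs" by (meson split_list)
    with xs show ?thesis
      by (intro exI[of _ "ys @ [z]"])
        (auto simp: walk_def successively_append_iff hd_append split: if_splits)
  next
    case False
    with xs z step.hyps(2) show ?thesis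
      by (intro exI[of _ "xs @ [z]"]) (auto simp: walk_def successively_append_iff)
  qed
qed

lemma graph_connected_iff:
  assumes "simple_edges V T"
  shows "graph_connected V T \<longleftrightarrow> V \<noteq> {} \<and> (\<forall>x\<in>V. \<forall>y\<in>V. conn T x y)"
  unfolding graph_connected_def
  using conn_imp_distinct_walk[OF _ assms] walk_imp_conn by metis

text \<open>Removing the closing edge of a cycle leaves a path between its ends, so that edge is no
  bridge. Conversely, an edge that is no bridge closes a path around it to a cycle.\<close>

lemma graph_cycle_iff:
  assumes "simple_edges V T"
  shows "(\<exists>xs. graph_cycle V T xs) \<longleftrightarrow> \<not> acyclic_edges T"
proof
  assume "\<exists>xs. graph_cycle V T xs"
  then obtain xs where xs: "walk V T xs" "length xs \<ge> 3" "distinct xs" "{last xs, hd xs} \<in> T"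
    unfolding graph_cycle_def by blast
  let ?a = "hd xs" and ?b = "last xs"
  obtain y z ys where eq: "xs = ?a # y # z # ys"
    using xs(2) by (auto simp: numeral_3_eq_3 Suc_le_length_iff)
  \<comment> \<open>The third vertex, supplied by the length bound, makes the closing edge differ
    from the first edge \<open>{?a, y}\<close>.\<close>
  have ne: "?a \<noteq> ?b" "?b \<noteq> y"
    using xs(3) eq by (metis distinct.simps(2) last.simps last_in_set list.distinct(1))+
  \<comment> \<open>After the first vertex the walk never returns to \<open>hd xs\<close>, so it avoids the closing edge.\<close>
  have "successively (\<lambda>x y. {x, y} \<in> T - {{?b, ?a}}) (y # z # ys)"
  proof (rule successively_mono[of "\<lambda>x y. {x, y} \<in> T"])
    show "successively (\<lambda>x y. {x, y} \<in> T) (y # z # ys)"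
      using xs(1) eq by (metis walk_def successively.simps(3))
    fix p q assume "p \<in> set (y # z # ys)" "q \<in> set (y # z # ys)" "{p, q} \<in> T"
    moreover have "?a \<notin> set (y # z # ys)" using xs(3) eq by (metis distinct.simps(2))
    ultimately show "{p, q} \<in> T - {{?b, ?a}}" by (auto simp: doubleton_eq_iff)
  qed
  moreover have "{?a, y} \<in> T - {{?b, ?a}}"
    using xs(1) eq ne by (metis Diff_iff doubleton_eq_iff singletonD successively.simps(3) walk_def)
  ultimately have "walk UNIV (T - {{?b, ?a}}) xs"
    unfolding walk_def using eq by (metis list.distinct(1) subset_UNIV successively.simps(3))
  then have "conn (T - {{?b, ?a}}) ?b ?a"
    by (meson conn_sym walk_imp_conn)
  with xs(4) show "\<not> acyclic_edges T" unfolding acyclic_edges_def by blast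
next
  assume "\<not> acyclic_edges T"
  then obtain a b where ab: "{a, b} \<in> T" "conn (T - {{a, b}}) a b"
    unfolding acyclic_edges_def by blast
  note V = simple_edgesD[OF assms ab(1)]
  have "simple_edges V (T - {{a, b}})" using assms by (simp add: simple_edges_def)
  then obtain xs where xs: "walk V (T - {{a, b}}) xs" "distinct xs" "hd xs = a" "last xs = b"
    using conn_imp_distinct_walk[OF ab(2)] V by blast
  have "walk V T xs"
    using xs(1) by (auto simp: walk_def elim: successively_mono)
  \<comment> \<open>One vertex would give \<open>a = b\<close>, and two would use the deleted
    edge.\<close>
  moreover have "length xs \<ge> 3"
  proof -
    consider "xs = []" | p where "xs = [p]" | p q where "xs = [p, q]"
      | p q r ys where "xs = p # q # r # ys"
      by (metis list.exhaust)
    then show ?thesis using xs V by cases (auto simp: walk_def)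
  qed
  ultimately show "\<exists>xs. graph_cycle V T xs"
    unfolding graph_cycle_def using xs ab(1) by (metis insert_commute)
qed

text \<open>With this characterisation the remaining arguments use \<open>conn\<close> instead of
  walks.\<close>

lemma graph_tree_iff:
  assumes "simple_edges V T"
  shows "graph_tree V T \<longleftrightarrow> V \<noteq> {} \<and> (\<forall>x\<in>V. \<forall>y\<in>V. conn T x y) \<and> acyclic_edges T"
  unfolding graph_tree_def
  using graph_connected_iff[OF assms] graph_cycle_iff[OF assms] by blast

text \<open>The new vertex meets the rest only through \<open>a\<close>, so it changes neither
  reachability within \<open>V\<close> nor the presence of cycles.\<close>

lemma graph_tree_leaf:
  assumes T: "simple_edges V T" and "w \<notin> V" "a \<in> V"
  shows "graph_tree (insert w V) (insert {w, a} T) \<longleftrightarrow> graph_tree V T"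
proof -
  have fresh: "\<And>e. e \<in> T \<Longrightarrow> w \<notin> e" using T assms(2) by (auto simp: simple_edges_def)
  have T': "simple_edges (insert w V) (insert {w, a} T)"
    using T assms by (auto simp: simple_edges_def card_insert_if)
  have notin: "{w, a} \<notin> T" using fresh by blast
  have wa: "w \<noteq> a" using assms by auto
  show ?thesis
    unfolding graph_tree_iff[OF T] graph_tree_iff[OF T'] acyclic_edges_insert[OF notin]
    using assms(2,3) wa by (auto simp: conn_insert_iff conn_fresh[OF fresh] dest: conn_sym)
qed

text \<open>The path \<open>u\<close>, \<open>w\<close>, \<open>v\<close> replaces the edge
  \<open>uv\<close>: reachability within \<open>V\<close> stays the same, and \<open>w\<close>
  reaches the same vertices of \<open>V\<close> as \<open>u\<close>.\<close>

lemma graph_tree_subdivide: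
  assumes T: "simple_edges V T" and "w \<notin> V" "u \<in> V" "v \<in> V" "u \<noteq> v" "{u, v} \<notin> T"
  shows "graph_tree (insert w V) (insert {w, u} (insert {w, v} T))
    \<longleftrightarrow> graph_tree V (insert {u, v} T)"
proof -
  have fresh: "\<And>e. e \<in> T \<Longrightarrow> w \<notin> e" using T assms(2) by (auto simp: simple_edges_def)
  have T': "simple_edges (insert w V) (insert {w, u} (insert {w, v} T))"
    "simple_edges V (insert {u, v} T)"
    using T assms by (auto simp: simple_edges_def card_insert_if)
  have notin: "{w, v} \<notin> T" "{w, u} \<notin> insert {w, v} T"
    using fresh assms by (auto simp: doubleton_eq_iff)
  have wuv: "w \<noteq> u" "w \<noteq> v" using assms by auto
  have conn: "conn (insert {w, u} (insert {w, v} T)) x y \<longleftrightarrow> conn (insert {u, v} T) x y"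
    if "x \<in> V" "y \<in> V" for x y
    using that assms(2) wuv by (auto simp: conn_insert_iff conn_fresh[OF fresh])
  have conn_w: "conn (insert {w, u} (insert {w, v} T)) x w \<longleftrightarrow> conn (insert {u, v} T) x u"
    "conn (insert {w, u} (insert {w, v} T)) w x \<longleftrightarrow> conn (insert {u, v} T) x u"
    if "x \<in> V" for x
    using that assms(2) wuv by (auto simp: conn_insert_iff conn_fresh[OF fresh] dest: conn_sym)
  have "acyclic_edges (insert {w, u} (insert {w, v} T)) \<longleftrightarrow> acyclic_edges (insert {u, v} T)"
    unfolding acyclic_edges_insert[OF notin(2)] acyclic_edges_insert[OF notin(1)]
      acyclic_edges_insert[OF assms(6)]
    using wuv by (auto simp: conn_insert_iff conn_fresh[OF fresh] dest: conn_sym)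
  then show ?thesis
    unfolding graph_tree_iff[OF T'(1)] graph_tree_iff[OF T'(2)]
    using assms(3) by (auto simp: conn conn_w)
qed

section \<open>Spanning trees after attaching a vertex to an edge\<close>

text \<open>The three families are the trees with \<open>w\<close> a leaf at \<open>u\<close>, those
  with \<open>w\<close> a leaf at \<open>v\<close>, and those with both edges at
  \<open>w\<close>.\<close>

lemma spanning_trees_extend:
  assumes E: "simple_edges V E" and w: "w \<notin> V" and uv: "{u, v} \<in> E"
  shows "spanning_trees (insert w V) (E \<union> {{w, u}, {w, v}}) =
    insert {w, u} ` spanning_trees V E \<union> insert {w, v} ` spanning_trees V E \<union>
    (\<lambda>T. insert {w, u} (insert {w, v} (T - {{u, v}}))) ` {T \<in> spanning_trees V E. {u, v} \<in> T}"
    (is "?L = ?A \<union> ?B \<union> ?C")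
proof -
  note V = simple_edgesD[OF E uv]
  have sub: "simple_edges V T" if "T \<subseteq> E" for T
    using that E by (auto simp: simple_edges_def)
  have fresh: "\<And>e. e \<in> E \<Longrightarrow> w \<notin> e" using E w by (auto simp: simple_edges_def)
  have leaf: "graph_tree (insert w V) (insert {w, a} T) \<longleftrightarrow> graph_tree V T"
    if "T \<subseteq> E" "a \<in> {u, v}" for T a
    using graph_tree_leaf[OF sub[OF that(1)] w] that(2) V by blast
  have subdiv: "graph_tree (insert w V) (insert {w, u} (insert {w, v} T))
    \<longleftrightarrow> graph_tree V (insert {u, v} T)" if "T \<subseteq> E" "{u, v} \<notin> T" for T
    using graph_tree_subdivide[OF sub[OF that(1)] w V that(2)] .
  show ?thesis
  proof (intro equalityI subsetI)
    fix T' assume "T' \<in> ?L"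
    then have T': "T' \<subseteq> E \<union> {{w, u}, {w, v}}" "graph_tree (insert w V) T'"
      by (auto simp: spanning_trees_def)
    define T where "T = T' \<inter> E"
    have T: "T \<subseteq> E" by (simp add: T_def)
    have T'_eq: "T' = T \<union> (T' \<inter> {{w, u}, {w, v}})" using T'(1) T_def by blast
    consider "T' = T" | "T' = insert {w, u} T" | "T' = insert {w, v} T"
      | "T' = insert {w, u} (insert {w, v} T)"
      using T'_eq by (cases "{w, u} \<in> T'"; cases "{w, v} \<in> T'") auto
    then show "T' \<in> ?A \<union> ?B \<union> ?C"
    proof cases
      case 1
      \<comment> \<open>Without an edge of the tree at it, \<open>w\<close> would be
        isolated.\<close>
      have "simple_edges (insert w V) T" using sub[OF T] by (auto simp: simple_edges_def)
      then have "conn T w u" using T'(2) 1 V by (simp add: graph_tree_iff)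
      then have "u = w" using conn_fresh(2)[of T w u] T fresh by blast
      then show ?thesis using V w by blast
    next
      case 2
      then show ?thesis using T' T leaf[of T u] by (auto simp: spanning_trees_def)
    next
      case 3
      then show ?thesis using T' T leaf[of T v] by (auto simp: spanning_trees_def)
    next
      case 4
      \<comment> \<open>Together with both edges at \<open>w\<close>, the edge \<open>uv\<close>
        would close a triangle.\<close>
      have "{u, v} \<notin> T"
      proof
        assume uvT: "{u, v} \<in> T"
        have notin: "{w, u} \<notin> insert {w, v} T" "{w, v} \<notin> T"
          using fresh T V w by (auto simp: doubleton_eq_iff)
        have "simple_edges (insert w V) T'"
          using E T'(1) V w by (auto simp: simple_edges_def card_insert_if)
        then have "acyclic_edges T'" using T'(2) by (simp add: graph_tree_iff)
        then have "\<not> conn (insert {w, v} T) w u"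
          using 4 acyclic_edges_insert[OF notin(1)] by blast
        moreover have "conn T v u" using uvT by (auto simp: insert_commute intro: conn_edge)
        ultimately show False by (simp add: conn_insert_iff)
      qed
      then have "insert {u, v} T \<in> {T \<in> spanning_trees V E. {u, v} \<in> T}"
        "T' = insert {w, u} (insert {w, v} (insert {u, v} T - {{u, v}}))"
        using T' T subdiv[of T] 4 uv by (auto simp: spanning_trees_def)
      then show ?thesis by blast
    qed
  next
    fix T' assume "T' \<in> ?A \<union> ?B \<union> ?C"
    then consider T a where "T \<in> spanning_trees V E" "a \<in> {u, v}" "T' = insert {w, a} T"
      | T where "T \<in> spanning_trees V E" "{u, v} \<in> T"
          "T' = insert {w, u} (insert {w, v} (T - {{u, v}}))"
      by blast
    then show "T' \<in> ?L"
    proof cases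
      case 1
      then show ?thesis using leaf[of T a] by (auto simp: spanning_trees_def)
    next
      case 2
      then have "insert {u, v} (T - {{u, v}}) = T" "T - {{u, v}} \<subseteq> E"
        by (auto simp: spanning_trees_def)
      then show ?thesis using 2 subdiv[of "T - {{u, v}}"] by (auto simp: spanning_trees_def)
    qed
  qed
qed

text \<open>The quantity \<open>N S\<close> of the opening explanation, for an arbitrary set
  \<open>S\<close> of prescribed edges.\<close>

definition tree_count :: "'a set \<Rightarrow> 'a set set \<Rightarrow> 'a set set \<Rightarrow> nat" where
  "tree_count V E S = card {T \<in> spanning_trees V E. S \<subseteq> T}"

text \<open>The three families of new trees are told apart by which edges at \<open>w\<close> they
  contain, and each is an injective image of old trees. Prescribing one edge at \<open>w\<close>
  discards just one of the two leaf families.\<close>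

lemma tree_count_extend:
  assumes E: "simple_edges V E" "finite E" and w: "w \<notin> V" and uv: "{u, v} \<in> E"
    and S: "S \<subseteq> E" "{u, v} \<notin> S"
  shows "tree_count (insert w V) (E \<union> {{w, u}, {w, v}}) S
      = 2 * tree_count V E S + tree_count V E (insert {u, v} S)"
    and "tree_count (insert w V) (E \<union> {{w, u}, {w, v}}) (insert {w, u} S)
      = tree_count V E S + tree_count V E (insert {u, v} S)"
    and "tree_count (insert w V) (E \<union> {{w, u}, {w, v}}) (insert {w, v} S)
      = tree_count V E S + tree_count V E (insert {u, v} S)"
proof -
  \<comment> \<open>Both leaf constructions \<open>f u\<close> and \<open>f v\<close> start from
    \<open>A\<close>; the subdivision \<open>g\<close> starts from \<open>B\<close>.\<close>
  define A where "A = {T \<in> spanning_trees V E. S \<subseteq> T}"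
  define B where "B = {T \<in> spanning_trees V E. insert {u, v} S \<subseteq> T}"
  define f where "f a T = insert {w, a} T" for a and T :: "'a set set"
  define g where "g T = insert {w, u} (insert {w, v} (T - {{u, v}}))" for T
  have wE: "{w, a} \<notin> E" for a using E(1) w by (auto simp: simple_edges_def)
  have uv_ne: "{w, u} \<noteq> {w, v}"
    using simple_edgesD[OF E(1) uv] by (auto simp: doubleton_eq_iff)
  have subE: "A \<subseteq> Pow E" "B \<subseteq> Pow E"
    by (auto simp: A_def B_def spanning_trees_def)
  have fin: "finite A" "finite B"
    using subE E(2) by (meson finite_Pow_iff finite_subset)+
  have inj_f: "inj_on (f a) A" for a
  proof (rule inj_on_inverseI)
    show "f a T - {{w, a}} = T" if "T \<in> A" for T
      using that subE(1) wE[of a] unfolding f_def by blast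
  qed
  have inj_g: "inj_on g B"
  proof (rule inj_on_inverseI)
    show "insert {u, v} (g T - {{w, u}, {w, v}}) = T" if "T \<in> B" for T
    proof -
      have "T \<subseteq> E" "{u, v} \<in> T" using that subE(2) by (auto simp: B_def)
      then show ?thesis using wE[of u] wE[of v] unfolding g_def by blast
    qed
  qed
  have fuD: "{w, u} \<in> X \<and> {w, v} \<notin> X" if "X \<in> f u ` A" for X
    using that subE(1) wE[of v] uv_ne by (auto simp: f_def)
  have fvD: "{w, v} \<in> X \<and> {w, u} \<notin> X" if "X \<in> f v ` A" for X
    using that subE(1) wE[of u] uv_ne by (auto simp: f_def)
  have gD: "{w, u} \<in> X \<and> {w, v} \<in> X" if "X \<in> g ` B" for X
    using that by (auto simp: g_def)
  have disj: "f u ` A \<inter> f v ` A = {}" "(f u ` A \<union> f v ` A) \<inter> g ` B = {}"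
    "f u ` A \<inter> g ` B = {}" "f v ` A \<inter> g ` B = {}"
    using fuD fvD gD by (meson Un_iff disjoint_iff)+
  \<comment> \<open>Since \<open>S\<close> consists of old edges other than \<open>uv\<close>,
    neither adding edges at \<open>w\<close> nor deleting \<open>uv\<close> affects whether it is
    contained.\<close>
  have subset_iff: "S \<subseteq> f a T \<longleftrightarrow> S \<subseteq> T" "S \<subseteq> g T \<longleftrightarrow> S \<subseteq> T" for a T
    using S wE by (auto simp: f_def g_def)
  have st: "spanning_trees (insert w V) (E \<union> {{w, u}, {w, v}}) =
    f u ` spanning_trees V E \<union> f v ` spanning_trees V E \<union>
    g ` {T \<in> spanning_trees V E. {u, v} \<in> T}"
    using spanning_trees_extend[OF E(1) w uv] by (simp add: f_def g_def)
  have eq: "{T \<in> spanning_trees (insert w V) (E \<union> {{w, u}, {w, v}}). S \<subseteq> T}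
      = f u ` A \<union> f v ` A \<union> g ` B"
    unfolding st A_def B_def using subset_iff by auto
  have filter: "{T \<in> spanning_trees (insert w V) (E \<union> {{w, u}, {w, v}}). insert e S \<subseteq> T}
      = {T \<in> f u ` A \<union> f v ` A \<union> g ` B. e \<in> T}" for e
    unfolding eq[symmetric] by auto
  have Collect_Un: "{T \<in> X \<union> Y \<union> Z. P T} = X \<union> Z"
    if "\<And>T. T \<in> X \<Longrightarrow> P T" "\<And>T. T \<in> Y \<Longrightarrow> \<not> P T" "\<And>T. T \<in> Z \<Longrightarrow> P T"
    for X Y Z :: "'a set set set" and P
    using that by auto
  have equ: "{T \<in> spanning_trees (insert w V) (E \<union> {{w, u}, {w, v}}).
      insert {w, u} S \<subseteq> T} = f u ` A \<union> g ` B"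
    unfolding filter by (rule Collect_Un) (drule fuD fvD gD, simp)+
  have eqv: "{T \<in> spanning_trees (insert w V) (E \<union> {{w, u}, {w, v}}).
      insert {w, v} S \<subseteq> T} = f v ` A \<union> g ` B"
    unfolding filter Un_commute[of "f u ` A"]
    by (rule Collect_Un) (drule fuD fvD gD, simp)+
  show "tree_count (insert w V) (E \<union> {{w, u}, {w, v}}) S
      = 2 * tree_count V E S + tree_count V E (insert {u, v} S)"
    unfolding tree_count_def eq A_def[symmetric] B_def[symmetric]
    by (simp add: card_Un_disjoint fin disj card_image inj_f inj_g)
  show "tree_count (insert w V) (E \<union> {{w, u}, {w, v}}) (insert {w, u} S)
      = tree_count V E S + tree_count V E (insert {u, v} S)"
    unfolding tree_count_def equ A_def[symmetric] B_def[symmetric]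
    by (simp add: card_Un_disjoint fin disj card_image inj_f inj_g)
  show "tree_count (insert w V) (E \<union> {{w, u}, {w, v}}) (insert {w, v} S)
      = tree_count V E S + tree_count V E (insert {u, v} S)"
    unfolding tree_count_def eqv A_def[symmetric] B_def[symmetric]
    by (simp add: card_Un_disjoint fin disj card_image inj_f inj_g)
qed

section \<open>The base case: a single triangle\<close>

lemma spanning_trees_triangle:
  assumes "distinct [a, b, c]"
  shows "spanning_trees {a, b, c} {{a, b}, {b, c}, {a, c}} =
    {{{a, b}, {b, c}}, {{a, b}, {a, c}}, {{b, c}, {a, c}}}"
proof -
  \<comment> \<open>The triangle is built by attaching \<open>a\<close> to the single vertex
    \<open>b\<close> as a leaf and then \<open>c\<close> to the edge \<open>ab\<close>, so the
    general extension result lists its trees.\<close>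
  have "graph_tree {b} {}"
    by (simp add: graph_tree_iff simple_edges_def acyclic_edges_def)
  then have ab: "graph_tree {a, b} {{a, b}}"
    using graph_tree_leaf[of "{b}" "{}" a b] assms by (simp add: simple_edges_def)
  have "\<not> graph_tree {a, b} {}"
    using assms by (auto simp: graph_tree_iff simple_edges_def)
  with ab have st: "spanning_trees {a, b} {{a, b}} = {{{a, b}}}"
    by (auto simp: spanning_trees_def subset_singleton_iff)
  have simple: "simple_edges {a, b} {{a, b}}" using assms by (auto simp: simple_edges_def)
  have c: "c \<notin> {a, b}" and ab_edge: "{a, b} \<in> {{a, b}}" using assms by auto
  have filter: "{T \<in> {{{a, b}}}. {a, b} \<in> T} = {{{a, b}}}" by auto
  have perm: "{{z, x}, {y, x}, {z, y}} = {{x, y}, {x, z}, {y, z}}" for x y z :: "'a set"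
    by (simp add: insert_commute)
  have "{a, b, c} = insert c {a, b}" "{{a, b}, {b, c}, {a, c}} = {{a, b}} \<union> {{c, a}, {c, b}}"
    by (simp_all add: insert_commute)
  then have "spanning_trees {a, b, c} {{a, b}, {b, c}, {a, c}} =
      spanning_trees (insert c {a, b}) ({{a, b}} \<union> {{c, a}, {c, b}})"
    by simp
  also have "\<dots> = {{{c, a}, {a, b}}, {{c, b}, {a, b}}, {{c, a}, {c, b}}}"
    unfolding spanning_trees_extend[OF simple c ab_edge] st filter
    by (simp add: insert_commute)
  also have "\<dots> = {{{a, b}, {b, c}}, {{a, b}, {a, c}}, {{b, c}, {a, c}}}"
    unfolding perm insert_commute[of c a "{}"] insert_commute[of c b "{}"]
    by (simp add: insert_commute)
  finally show ?thesis .
qed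

text \<open>The values are \<open>fib 4\<close>, \<open>fib 3\<close> and \<open>fib 2\<close>. All
  edges are allowed, since every vertex of the triangle has degree 2.\<close>

lemma tree_count_triangle:
  assumes "distinct [a, b, c]"
  defines "E \<equiv> {{a, b}, {b, c}, {a, c}}"
  shows "tree_count {a, b, c} E {} = 3"
    and "e \<in> E \<Longrightarrow> tree_count {a, b, c} E {e} = 2"
    and "e \<in> E \<Longrightarrow> f \<in> E \<Longrightarrow> e \<noteq> f \<Longrightarrow> tree_count {a, b, c} E {e, f} = 1"
proof -
  define x y z where "x = {a, b}" "y = {b, c}" "z = {a, c}"
  have ne: "x \<noteq> y" "x \<noteq> z" "y \<noteq> z"
    using assms(1) by (auto simp: x_y_z_def doubleton_eq_iff)
  have E: "E = {x, y, z}" by (simp add: E_def x_y_z_def)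
  have st: "spanning_trees {a, b, c} E = {{x, y}, {x, z}, {y, z}}"
    using spanning_trees_triangle[OF assms(1)] by (simp add: E_def x_y_z_def)
  have ne2: "{x, y} \<noteq> {x, z}" "{x, y} \<noteq> {y, z}" "{x, z} \<noteq> {y, z}"
    using ne by (auto simp: doubleton_eq_iff)
  have Collect3: "{T \<in> {p, q, r}. P T} =
    (if P p then {p} else {}) \<union> (if P q then {q} else {}) \<union> (if P r then {r} else {})"
    for p q r :: "'a set set" and P by auto
  show "tree_count {a, b, c} E {} = 3"
    unfolding tree_count_def st Collect3 using ne2 by simp
  show "tree_count {a, b, c} E {e} = 2" if "e \<in> E"
    unfolding tree_count_def st Collect3 using that unfolding E
    by (elim insertE emptyE) (simp_all add: ne ne2 ne[symmetric] ne2[symmetric])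
  show "tree_count {a, b, c} E {e, f} = 1" if "e \<in> E" "f \<in> E" "e \<noteq> f"
    unfolding tree_count_def st Collect3 using that unfolding E
    by (elim insertE emptyE) (simp_all add: ne ne2 ne[symmetric] ne2[symmetric])
qed

section \<open>Induction along a linear 2-tree\<close>

lemma degree_extend:
  assumes "simple_edges V E" "finite E" "w \<notin> V" "{u, v} \<in> E"
  shows "degree (E \<union> {{w, u}, {w, v}}) w = 2"
    and "x \<in> {u, v} \<Longrightarrow> degree (E \<union> {{w, u}, {w, v}}) x = Suc (degree E x)"
    and "x \<notin> {u, v, w} \<Longrightarrow> degree (E \<union> {{w, u}, {w, v}}) x = degree E x"
proof -
  note V = simple_edgesD[OF assms(1,4)]
  have wE: "e \<in> E \<Longrightarrow> w \<notin> e" for e using assms by (auto simp: simple_edges_def)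
  have ne: "{w, u} \<noteq> {w, v}" using V by (auto simp: doubleton_eq_iff)
  have "{e \<in> E \<union> {{w, u}, {w, v}}. w \<in> e} = {{w, u}, {w, v}}"
    using wE by auto
  then show "degree (E \<union> {{w, u}, {w, v}}) w = 2"
    using ne by (simp add: degree_def)
  show "degree (E \<union> {{w, u}, {w, v}}) x = Suc (degree E x)" if x: "x \<in> {u, v}"
  proof -
    have "{e \<in> E \<union> {{w, u}, {w, v}}. x \<in> e} = insert {w, x} {e \<in> E. x \<in> e}"
      using x V assms(3) by auto
    moreover have "{w, x} \<notin> {e \<in> E. x \<in> e}" using wE by blast
    ultimately show ?thesis using assms(2) by (simp add: degree_def)
  qed
  show "degree (E \<union> {{w, u}, {w, v}}) x = degree E x" if "x \<notin> {u, v, w}"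
  proof -
    have "{e \<in> E \<union> {{w, u}, {w, v}}. x \<in> e} = {e \<in> E. x \<in> e}" using that by auto
    then show ?thesis by (simp add: degree_def)
  qed
qed

lemma card3_obtain:
  assumes "card t = 3" "w \<in> t"
  obtains x y where "t = {w, x, y}" "w \<noteq> x" "w \<noteq> y" "x \<noteq> y"
proof -
  have "card (t - {w}) = 2" using assms by simp
  then obtain x y where "t - {w} = {x, y}" "x \<noteq> y" by (meson card_2_iff)
  with assms(2) that[of x y] show ?thesis by blast
qed

text \<open>The other two corners of a triangle at \<open>w\<close> are neighbours of
  \<open>w\<close>, hence \<open>u\<close> and \<open>v\<close>. So each extension step adds exactly
  one triangle.\<close>

lemma triangles_extend:
  assumes "simple_edges V E" "w \<notin> V" "{u, v} \<in> E"
  shows "triangles (insert w V) (E \<union> {{w, u}, {w, v}}) = insert {w, u, v} (triangles V E)"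
proof (intro equalityI subsetI)
  have wE: "e \<in> E \<Longrightarrow> w \<notin> e" for e using assms by (auto simp: simple_edges_def)
  fix t assume "t \<in> triangles (insert w V) (E \<union> {{w, u}, {w, v}})"
  then have t: "t \<subseteq> insert w V" "card t = 3"
    and adj: "\<And>x y. x \<in> t \<Longrightarrow> y \<in> t \<Longrightarrow> x \<noteq> y \<Longrightarrow> {x, y} \<in> E \<union> {{w, u}, {w, v}}"
    by (auto simp: triangles_def)
  show "t \<in> insert {w, u, v} (triangles V E)"
  proof (cases "w \<in> t")
    case True
    then obtain x y where xy: "t = {w, x, y}" "w \<noteq> x" "w \<noteq> y" "x \<noteq> y"
      using card3_obtain[OF t(2)] by metis
    have "{w, x} \<in> E \<union> {{w, u}, {w, v}}" "{w, y} \<in> E \<union> {{w, u}, {w, v}}"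
      using adj xy by auto
    then have "x \<in> {u, v}" "y \<in> {u, v}" using wE by (auto simp: doubleton_eq_iff)
    then show ?thesis using xy by auto
  next
    case False
    have "{x, y} \<in> E" if "x \<in> t" "y \<in> t" "x \<noteq> y" for x y
      using adj[OF that] that False by (auto simp: doubleton_eq_iff)
    then show ?thesis using t False by (auto simp: triangles_def)
  qed
next
  note V = simple_edgesD[OF assms(1,3)]
  have "{x, y} \<in> E \<union> {{w, u}, {w, v}}"
    if "x \<in> {w, u, v}" "y \<in> {w, u, v}" "x \<noteq> y" for x y
    using that assms(3) by (auto simp: insert_commute)
  moreover have "w \<noteq> u" "w \<noteq> v" using V assms(2) by auto
  then have "card {w, u, v} = 3" "{w, u, v} \<subseteq> insert w V" using V by auto
  ultimately have "{w, u, v} \<in> triangles (insert w V) (E \<union> {{w, u}, {w, v}})"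
    unfolding triangles_def by blast
  moreover have "triangles V E \<subseteq> triangles (insert w V) (E \<union> {{w, u}, {w, v}})"
    unfolding triangles_def by blast
  moreover fix t assume "t \<in> insert {w, u, v} (triangles V E)"
  ultimately show "t \<in> triangles (insert w V) (E \<union> {{w, u}, {w, v}})" by blast
qed

lemma triangles_triangle:
  assumes "distinct [a, b, c]"
  shows "triangles {a, b, c} {{a, b}, {b, c}, {a, c}} = {{a, b, c}}"
proof -
  have "t = {a, b, c}" if "t \<subseteq> {a, b, c}" "card t = 3" for t
    using that assms by (intro card_subset_eq) auto
  moreover have "{x, y} \<in> {{a, b}, {b, c}, {a, c}}"
    if "x \<in> {a, b, c}" "y \<in> {a, b, c}" "x \<noteq> y" for x y
    using that by (auto simp: insert_commute)
  moreover have "card {a, b, c} = 3" using assms by simp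
  ultimately show ?thesis unfolding triangles_def by blast
qed

section \<open>Vertices of degree 2 in a linear 2-tree\<close>

lemma linear_2tree_simple:
  assumes "linear_2tree V E"
  shows "finite V" "finite E" "simple_edges V E"
  using assms
  by (induction) (auto simp: simple_edges_def card_insert_if)

lemma linear_2tree_degree_ge_2:
  assumes "linear_2tree V E" "x \<in> V"
  shows "degree E x \<ge> 2"
  using assms
proof (induction arbitrary: x)
  case (triangle a b c)
  have "\<exists>e f. e \<noteq> f \<and> {e, f} \<subseteq> {e \<in> {{a, b}, {b, c}, {a, c}}. x \<in> e}"
  proof -
    consider "x = a" | "x = b" | "x = c" using triangle.prems by blast
    then show ?thesis
    proof cases
      case 1
      with triangle.hyps show ?thesis
        by (intro exI[of _ "{a, b}"] exI[of _ "{a, c}"]) (auto simp: doubleton_eq_iff)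
    next
      case 2
      with triangle.hyps show ?thesis
        by (intro exI[of _ "{a, b}"] exI[of _ "{b, c}"]) (auto simp: doubleton_eq_iff)
    next
      case 3
      with triangle.hyps show ?thesis
        by (intro exI[of _ "{a, c}"] exI[of _ "{b, c}"]) (auto simp: doubleton_eq_iff)
    qed
  qed
  then obtain e f where ef: "e \<noteq> f" "{e, f} \<subseteq> {e \<in> {{a, b}, {b, c}, {a, c}}. x \<in> e}" by blast
  have "card {e, f} \<le> card {e \<in> {{a, b}, {b, c}, {a, c}}. x \<in> e}"
    by (rule card_mono[OF _ ef(2)]) simp
  then show ?case using ef(1) by (simp add: degree_def)
next
  case (extend V E u v w)
  note deg = degree_extend[OF linear_2tree_simple(3,2)[OF extend.hyps(1)] extend.hyps(4,2)]
  show ?case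
  proof (cases "x \<in> {u, v, w}")
    case True
    have "u \<in> V" "v \<in> V"
      using simple_edgesD[OF linear_2tree_simple(3)[OF extend.hyps(1)] extend.hyps(2)] by auto
    with True extend.IH[of u] extend.IH[of v] deg(1) deg(2)[of u] deg(2)[of v]
    show ?thesis by auto
  next
    case False
    then show ?thesis using deg(3)[of x] extend.IH[of x] extend.prems by auto
  qed
qed

text \<open>The degrees of \<open>u\<close> and \<open>v\<close> were at least 2 and grow by one, so
  neither has degree 2 afterwards; other old degrees stay the same.\<close>

lemma linear_2tree_extend_degree_2:
  assumes "linear_2tree V E" "{u, v} \<in> E" "w \<notin> V"
    and "x \<in> insert w V" "degree (E \<union> {{w, u}, {w, v}}) x = 2" "x \<noteq> w"
  shows "x \<in> V" "x \<noteq> u" "x \<noteq> v" "degree E x = 2"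
proof -
  note simp = linear_2tree_simple[OF assms(1)]
  note deg = degree_extend[OF simp(3,2) assms(3,2)]
  show "x \<in> V" using assms by auto
  then have "degree E x \<ge> 2" using linear_2tree_degree_ge_2[OF assms(1)] by blast
  then have *: "x \<notin> {u, v}" using deg(2)[of x] assms(5) by auto
  then show "x \<noteq> u" "x \<noteq> v" by auto
  show "degree E x = 2" using deg(3)[of x] * assms by auto
qed

text \<open>Only the triangle itself has three vertices of degree 2. This is where the requirement
  that \<open>u\<close> have degree 2 restricts the shape of the graph.\<close>

lemma linear_2tree_three_degree_2:
  assumes "linear_2tree V E"
    and "x \<in> V" "y \<in> V" "z \<in> V" "distinct [x, y, z]"
    and "degree E x = 2" "degree E y = 2" "degree E z = 2"
  shows "V = {x, y, z}"
  using assms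
proof (induction arbitrary: x y z)
  case (triangle a b c)
  then show ?case by auto
next
  case (extend V E u v w)
  note V = simple_edgesD[OF linear_2tree_simple(3)[OF extend.hyps(1)] extend.hyps(2)]
  note old = linear_2tree_extend_degree_2[OF extend.hyps(1,2,4)]
  have False if "p \<in> {x, y, z}" "q \<in> {x, y, z}" "p \<noteq> q" "p \<noteq> w" "q \<noteq> w" for p q
  proof -
    have p: "p \<in> V" "p \<noteq> u" "p \<noteq> v" "degree E p = 2"
      using old[of p] that extend.prems by auto
    have q: "q \<in> V" "q \<noteq> u" "q \<noteq> v" "degree E q = 2"
      using old[of q] that extend.prems by auto
    \<comment> \<open>Before the extension \<open>u\<close> had degree 2 as well, so
      \<open>p\<close>, \<open>q\<close>, \<open>u\<close> would be the whole old graph, leaving no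
      room for \<open>v\<close>.\<close>
    have "V = {p, q, u}"
      using extend.IH[of p q u] p q that V extend.hyps(3) by auto
    then show False using V p q by auto
  qed
  from this[of x y] this[of x z] this[of y z] show ?case
    using extend.prems by auto
qed

section \<open>The Fibonacci recursion and the final induction\<close>

lemma fib_even_rec:
  "fib (2 * Suc m + 2) = 2 * fib (2 * m + 2) + fib (2 * m + 1)"
  "fib (2 * Suc m + 1) = fib (2 * m + 2) + fib (2 * m + 1)"
  "fib (2 * Suc m + 1) = 2 * fib (2 * m + 1) + fib (2 * m)"
  "fib (2 * Suc m) = fib (2 * m + 1) + fib (2 * m)"
  by (simp_all add: numeral_eq_Suc)

text \<open>The three counts are proved together, since each step adds \<open>uv\<close> to the
  prescribed edges. The recursion closes because \<open>uv\<close> is itself an edge at a vertex of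
  degree 2, namely \<open>u\<close>, and because two such vertices of the new graph always include
  \<open>w\<close>, so a third prescribed edge never arises.\<close>

lemma tree_count_linear_2tree:
  assumes "linear_2tree V E" "card (triangles V E) = m"
  shows "tree_count V E {} = fib (2 * m + 2)"
    and "\<And>x e. x \<in> e \<Longrightarrow> e \<in> E \<Longrightarrow> degree E x = 2 \<Longrightarrow> tree_count V E {e} = fib (2 * m + 1)"
    and "\<And>x y e f. x \<in> e \<Longrightarrow> e \<in> E \<Longrightarrow> degree E x = 2 \<Longrightarrow> y \<in> f \<Longrightarrow> f \<in> E \<Longrightarrow> degree E y = 2 \<Longrightarrow>
           x \<noteq> y \<Longrightarrow> e \<noteq> f \<Longrightarrow> tree_count V E {e, f} = fib (2 * m)"
proof -
  have "tree_count V E {} = fib (2 * m + 2) \<and>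
    (\<forall>x e. x \<in> e \<longrightarrow> e \<in> E \<longrightarrow> degree E x = 2 \<longrightarrow> tree_count V E {e} = fib (2 * m + 1)) \<and>
    (\<forall>x y e f. x \<in> e \<longrightarrow> e \<in> E \<longrightarrow> degree E x = 2 \<longrightarrow> y \<in> f \<longrightarrow> f \<in> E \<longrightarrow> degree E y = 2 \<longrightarrow>
       x \<noteq> y \<longrightarrow> e \<noteq> f \<longrightarrow> tree_count V E {e, f} = fib (2 * m))"
    using assms
  proof (induction arbitrary: m)
    case (triangle a b c)
    then have "m = 1" using triangles_triangle[of a b c] by simp
    then show ?case
      using tree_count_triangle[OF triangle.hyps] by (auto simp: numeral_eq_Suc)
  next
    case (extend V E u v w)
    define E' where "E' = E \<union> {{w, u}, {w, v}}"
    define V' where "V' = insert w V"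
    note fs = linear_2tree_simple[OF extend.hyps(1)]
    note V = simple_edgesD[OF fs(3) extend.hyps(2)]
    note old = linear_2tree_extend_degree_2[OF extend.hyps(1,2,4)]
    note count = tree_count_extend[OF fs(3,2) extend.hyps(4,2), folded E'_def V'_def]
    define k where "k = card (triangles V E)"
    note IH = extend.IH[OF k_def[symmetric]]
    have "finite (triangles V E)"
      by (rule finite_subset[of _ "Pow V"]) (auto simp: triangles_def fs)
    moreover have "{w, u, v} \<notin> triangles V E" using extend.hyps(4) by (auto simp: triangles_def)
    ultimately have m: "m = Suc k"
      using extend.prems triangles_extend[OF fs(3) extend.hyps(4,2)] k_def by simp
    have IH0: "tree_count V E {} = fib (2 * k + 2)" using IH by blast
    have IH1: "tree_count V E {e} = fib (2 * k + 1)"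
      if "x \<in> e" "e \<in> E" "degree E x = 2" for x e using IH that by blast
    have IH2: "tree_count V E {e, f} = fib (2 * k)"
      if "x \<in> e" "e \<in> E" "degree E x = 2" "y \<in> f" "f \<in> E" "degree E y = 2" "x \<noteq> y" "e \<noteq> f"
      for x y e f using IH that by blast
    have uv: "tree_count V E {{u, v}} = fib (2 * k + 1)"
      using IH1[of u] extend.hyps by simp
    have edge_w: "e = {w, u} \<or> e = {w, v}" if "e \<in> E'" "w \<in> e" for e
      using that fs(3) extend.hyps(4) by (auto simp: E'_def simple_edges_def)
    \<comment> \<open>A vertex of degree 2 other than \<open>w\<close> is neither \<open>u\<close>
      nor \<open>v\<close>, so its edges are old and differ from \<open>uv\<close>.\<close>
    have edge_old: "e \<in> E \<and> degree E x = 2 \<and> e \<noteq> {u, v} \<and> x \<noteq> u"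
      if "e \<in> E'" "x \<in> e" "x \<noteq> w" "degree E' x = 2" for x e
    proof -
      have "x \<in> insert w V"
        using that fs(3) V by (auto simp: E'_def simple_edges_def)
      from old[OF this that(4)[unfolded E'_def] that(3)] that show ?thesis
        by (auto simp: E'_def)
    qed
    have c0: "tree_count V' E' {} = fib (2 * m + 2)"
      using count(1)[of "{}"] IH0 uv fib_even_rec(1)[of k] by (simp add: m)
    have c1: "tree_count V' E' {e} = fib (2 * m + 1)"
      if e: "x \<in> e" "e \<in> E'" "degree E' x = 2" for x e
    proof (cases "x = w")
      case True
      then show ?thesis
        using edge_w[of e] e count(2,3)[of "{}"] IH0 uv fib_even_rec(2)[of k] by (auto simp: m)
    next
      case False
      note o = edge_old[OF e(2,1) False e(3)]
      have S: "{e} \<subseteq> E" "{u, v} \<notin> {e}" using o by auto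
      \<comment> \<open>The edges \<open>uv\<close> and \<open>e\<close> lie at the distinct old
        vertices \<open>u\<close> and \<open>x\<close> of degree 2, so the two-edge count
        applies.\<close>
      have "tree_count V E {{u, v}, e} = fib (2 * k)"
        using IH2[of u "{u, v}" x e] o e extend.hyps by auto
      moreover have "tree_count V E {e} = fib (2 * k + 1)"
        using IH1[OF e(1)] o by blast
      ultimately show ?thesis
        unfolding m fib_even_rec(3) using count(1)[OF S] by simp
    qed
    have c2w: "tree_count V' E' {f, e} = fib (2 * m)"
      if e: "x \<in> e" "e \<in> E'" "degree E' x = 2" and f: "w \<in> f" "f \<in> E'" and "x \<noteq> w" for x e f
    proof -
      note o = edge_old[OF e(2,1) that(6) e(3)]
      have S: "{e} \<subseteq> E" "{u, v} \<notin> {e}" using o by auto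
      have "tree_count V E {{u, v}, e} = fib (2 * k)"
        using IH2[of u "{u, v}" x e] o e extend.hyps by auto
      moreover have "tree_count V E {e} = fib (2 * k + 1)"
        using IH1[OF e(1)] o by blast
      ultimately show ?thesis
        unfolding m fib_even_rec(4) using count(2,3)[OF S] edge_w[OF f(2,1)] by auto
    qed
    have c2: "tree_count V' E' {e, f} = fib (2 * m)"
      if e: "x \<in> e" "e \<in> E'" "degree E' x = 2" and f: "y \<in> f" "f \<in> E'" "degree E' y = 2"
        and ne: "x \<noteq> y" "e \<noteq> f" for x y e f
    proof -
      \<comment> \<open>Otherwise \<open>x\<close>, \<open>y\<close>, \<open>u\<close> would be
        three vertices of degree 2 in the old graph and hence all of it, although \<open>v\<close>
        differs from each.\<close>
      have "x = w \<or> y = w"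
      proof (rule ccontr)
        assume "\<not> (x = w \<or> y = w)"
        moreover have "x \<in> insert w V" "y \<in> insert w V"
          using e f fs(3) V by (auto simp: E'_def simple_edges_def)
        ultimately have xy: "x \<in> V" "x \<noteq> u" "x \<noteq> v" "degree E x = 2"
          "y \<in> V" "y \<noteq> u" "y \<noteq> v" "degree E y = 2"
          using old[of x] old[of y] e(3) f(3) by (auto simp: E'_def)
        then have "V = {x, y, u}"
          using linear_2tree_three_degree_2[OF extend.hyps(1), of x y u] V extend.hyps(3) ne by auto
        then show False using V xy by auto
      qed
      then show ?thesis
      proof
        assume "x = w"
        then show ?thesis using c2w[of y f e] e f ne by simp
      next
        assume "y = w"
        then show ?thesis using c2w[of x e f] e f ne by (simp add: insert_commute)
      qed
    qed
    show ?case
      unfolding E'_def[symmetric] V'_def[symmetric] using c0 c1 c2 by blast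
  qed
  then show "tree_count V E {} = fib (2 * m + 2)"
    and "\<And>x e. x \<in> e \<Longrightarrow> e \<in> E \<Longrightarrow> degree E x = 2 \<Longrightarrow> tree_count V E {e} = fib (2 * m + 1)"
    and "\<And>x y e f. x \<in> e \<Longrightarrow> e \<in> E \<Longrightarrow> degree E x = 2 \<Longrightarrow> y \<in> f \<Longrightarrow> f \<in> E \<Longrightarrow> degree E y = 2 \<Longrightarrow>
           x \<noteq> y \<Longrightarrow> e \<noteq> f \<Longrightarrow> tree_count V E {e, f} = fib (2 * m)"
    by blast+
qed

theorem theorem7p5:
  fixes V :: "'a set" and E :: "'a set set" and m :: nat
  assumes "m \<ge> 1"
    and "linear_2tree V E"
    and "card (triangles V E) = m"
  shows "card (spanning_trees V E) = fib (2 * m + 2)"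
  using tree_count_linear_2tree(1)[OF assms(2,3)] by (simp add: tree_count_def)

end
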